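(* There exist universal constants $0<c\le C<\infty$ such that for every $n\in\mathbb{N}$ and all $a_{i,j}\in\mathbb{R}$, $1\le i<j\le n$, setting $$ Q:=\max\Big\{\sum_{i=1}^{n-1}\Big(\sum_{j=i+1}^n a_{i,j}^2\Big)^{1/2},\ \sum_{j=2}^n\Big(\sum_{i=1}^{j-1} a_{i,j}^2\Big)^{1/2}\Big\}, $$ both of the quantities $\mathrm{disc}(K_n,\{a_{i,j}\}_{i<j})$ and $\mathsf{E}_\theta\,\mathrm{disc}(K_n,\{a_{i,j}\}_{i<j},\theta)$ lie between $cQ$ and $CQ$.
   Context: $K_n$ is the complete graph with vertices $v_1,\dots,v_n$, and the weight $a_{i,j}$ is assigned to the edge $(v_i,v_j)$, $1\le i<j\le n$. For an edge-coloring $\theta=(\theta_{i,j})_{1\le i<j\le n}$, $\theta_{i,j}\in\{-1,1\}$, the discrepancy with respect to $\theta$ is $$\mathrm{disc}(K_n,\{a_{i,j}\}_{i<j},\theta):=\max\Big\{\Big|\sum_{i,j\in I,\ i<j}\theta_{i,j}a_{i,j}\Big|:\ I\subset\{1,\dots,n\}\Big\},$$ and $\mathrm{disc}(K_n,\{a_{i,j}\}_{i<j}):=\min_\theta\mathrm{disc}(K_n,\{a_{i,j}\}_{i<j},\theta)$. $\mathsf{E}_\theta$ denotes the expectation (uniform average) over all edge-colorings $\theta$. *)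

theory Defs
  imports "HOL-Probability.Probability"
begin

text \<open>
  The edge \<open>{v_i, v_j}\<close> of the complete graph on \<open>{1..n}\<close> is represented by the pair \<open>(i, j)\<close>
  with \<open>i < j\<close>. Weights are functions on all pairs, but only their values on \<open>edges n\<close> are used.
\<close>

definition edges :: "nat \<Rightarrow> (nat \<times> nat) set" where
  "edges n = {(i, j). 1 \<le> i \<and> i < j \<and> j \<le> n}"

text \<open>Extensionality makes this a finite set with one element per colouring of the edges.\<close>

definition colorings :: "nat \<Rightarrow> (nat \<times> nat \<Rightarrow> real) set" where
  "colorings n = edges n \<rightarrow>\<^sub>E {-1, 1}"

definition disc_coloring :: "nat \<Rightarrow> (nat \<times> nat \<Rightarrow> real) \<Rightarrow> (nat \<times> nat \<Rightarrow> real) \<Rightarrow> real" where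
  "disc_coloring n a \<theta> =
     Max ((\<lambda>I. \<bar>\<Sum>e | e \<in> edges n \<and> fst e \<in> I \<and> snd e \<in> I. \<theta> e * a e\<bar>) ` Pow {1..n})"

definition disc :: "nat \<Rightarrow> (nat \<times> nat \<Rightarrow> real) \<Rightarrow> real" where
  "disc n a = Min (disc_coloring n a ` colorings n)"

definition expected_disc :: "nat \<Rightarrow> (nat \<times> nat \<Rightarrow> real) \<Rightarrow> real" where
  "expected_disc n a = measure_pmf.expectation (pmf_of_set (colorings n)) (disc_coloring n a)"

definition Q :: "nat \<Rightarrow> (nat \<times> nat \<Rightarrow> real) \<Rightarrow> real" where
  "Q n a = max (\<Sum>i = 1..n - 1. sqrt (\<Sum>j = i + 1..n. (a (i, j))\<^sup>2))
               (\<Sum>j = 2..n. sqrt (\<Sum>i = 1..j - 1. (a (i, j))\<^sup>2))"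

lemma finite_edges: "finite (edges n)"
  by (rule finite_subset[of _ "{1..n} \<times> {1..n}"]) (auto simp: edges_def)

lemma finite_colorings: "finite (colorings n)"
  unfolding colorings_def by (intro finite_PiE finite_edges) auto

lemma colorings_nonempty: "colorings n \<noteq> {}"
  by (simp add: colorings_def PiE_eq_empty_iff)

lemma expected_disc_eq_average:
  "expected_disc n a = (\<Sum>\<theta>\<in>colorings n. disc_coloring n a \<theta>) / real (card (colorings n))"
  unfolding expected_disc_def
  by (rule integral_pmf_of_set[OF colorings_nonempty finite_colorings])

end

theory Submission
  imports Defs
begin

text \<open>
  Write \<open>b = \<theta> a\<close> for the signed weights. The lower bound holds for each colouring separately, with the
  same constant; the upper bound holds on average. Since the minimum over colourings is at most the
  average, these two facts control both quantities.

  Lower bound. If every subset of vertices spans a total of size at most \<open>D\<close>, then by polarization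
  the symmetric bilinear form of \<open>b\<close> is at most \<open>4 D\<close> on every pair of vertex sets \<open>A\<close>, \<open>B\<close>.
  Letting \<open>B\<close> collect the columns \<open>j\<close> with a positive (or a nonpositive) sum over \<open>A\<close> gives
  \<open>\<Sum>j. \<bar>\<Sum>i\<in>A. b i j\<bar> \<le> 8 D\<close>. For a uniformly random \<open>A\<close> the expectation of each summand is
  bounded below by a multiple of the Euclidean norm of column \<open>j\<close>, by Khintchine's inequality
  (\<open>khintchine_L1_lower\<close>), in which \<open>\<bar>b\<bar> = \<bar>a\<bar>\<close>. This is \<open>sum_column_norms_le\<close>.

  Upper bound. Split the edges spanned by \<open>I\<close> into rows by their smaller endpoint, so that the total
  is at most \<open>\<Sum>i. \<bar>Z i I\<bar>\<close>, where \<open>Z i I\<close> is the sum of \<open>\<theta> (i, j) a (i, j)\<close> over \<open>j \<in> I\<close>. For one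
  \<open>I\<close> the mean of \<open>\<bar>Z i I\<bar>\<close> is at most the Euclidean norm of row \<open>i\<close>. To take the maximum over \<open>I\<close>
  inside the expectation, symmetrize against an independent copy and use that the absolute value is a
  contraction: up to the sum of the row norms, each \<open>\<bar>Z i I\<bar>\<close> may be replaced by \<open>2 Z i I\<close>
  (\<open>average_Max_abs_le\<close>). Once all absolute values are gone the sum is linear in the indicator of
  \<open>I\<close>, so its maximum is at most the sum over columns of the absolute values of the full column sums,
  and these have mean at most the column norms.
\<close>

section \<open>Averages over finite sets\<close>

definition average :: "'a set \<Rightarrow> ('a \<Rightarrow> real) \<Rightarrow> real" where
  "average S f = (\<Sum>x\<in>S. f x) / real (card S)"

lemma average_mono: "(\<And>x. x \<in> S \<Longrightarrow> f x \<le> g x) \<Longrightarrow> average S f \<le> average S g"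
  unfolding average_def by (intro divide_right_mono sum_mono) auto

lemma average_cong: "(\<And>x. x \<in> S \<Longrightarrow> f x = g x) \<Longrightarrow> average S f = average S g"
  unfolding average_def by simp

lemma average_add: "average S (\<lambda>x. f x + g x) = average S f + average S g"
  unfolding average_def by (simp add: sum.distrib add_divide_distrib)

lemma average_diff: "average S (\<lambda>x. f x - g x) = average S f - average S g"
  unfolding average_def by (simp add: sum_subtractf diff_divide_distrib)

lemma average_cmult: "average S (\<lambda>x. c * f x) = c * average S f"
  unfolding average_def by (simp add: sum_distrib_left)

lemma average_sum: "average S (\<lambda>x. \<Sum>k\<in>K. f k x) = (\<Sum>k\<in>K. average S (f k))"
  unfolding average_def by (subst sum.swap) (simp add: sum_divide_distrib)

lemma average_const: "finite S \<Longrightarrow> S \<noteq> {} \<Longrightarrow> average S (\<lambda>_. c) = c"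
  unfolding average_def by simp

lemma average_reindex: "bij_betw h S S \<Longrightarrow> average S (\<lambda>x. f (h x)) = average S f"
  unfolding average_def by (simp add: sum.reindex_bij_betw)

lemma average_pairs:
  "average (S \<times> S) (\<lambda>p. f (fst p) (snd p)) = average S (\<lambda>x. average S (f x))"
  unfolding average_def
  by (simp add: sum.cartesian_product' sum_divide_distrib card_cartesian_product)

lemma power2_average_le:
  assumes "finite S" "S \<noteq> {}"
  shows "(average S f)\<^sup>2 \<le> average S (\<lambda>x. (f x)\<^sup>2)"
proof -
  define m where "m = average S f"
  have "0 \<le> average S (\<lambda>x. (f x - m)\<^sup>2)"
    unfolding average_def by (intro divide_nonneg_nonneg sum_nonneg) auto
  also have "\<dots> = average S (\<lambda>x. (f x)\<^sup>2 - 2 * m * f x + m\<^sup>2)"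
    by (intro average_cong) (simp add: power2_eq_square algebra_simps)
  also have "\<dots> = average S (\<lambda>x. (f x)\<^sup>2) - 2 * m * m + m\<^sup>2"
    by (simp add: average_add average_diff average_cmult average_const[OF assms] m_def)
  finally show ?thesis by (simp add: m_def power2_eq_square)
qed

section \<open>Independent random signs\<close>

definition signs :: "'e set \<Rightarrow> ('e \<Rightarrow> real) set" where
  "signs E = E \<rightarrow>\<^sub>E {-1, 1}"

definition flip :: "'e set \<Rightarrow> ('e \<Rightarrow> real) \<Rightarrow> 'e \<Rightarrow> real" where
  "flip R \<theta> e = (if e \<in> R then - \<theta> e else \<theta> e)"

text \<open>
  Exchanging the coordinates in \<open>R\<close> between two independent sign vectors preserves their joint law.
  This expresses the independence of \<open>R\<close> from the other coordinates without ever writing the space of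
  sign vectors as a product.
\<close>

definition exchange :: "'e set \<Rightarrow> ('e \<Rightarrow> real) \<times> ('e \<Rightarrow> real) \<Rightarrow> ('e \<Rightarrow> real) \<times> ('e \<Rightarrow> real)" where
  "exchange R p = (\<lambda>e. if e \<in> R then snd p e else fst p e, \<lambda>e. if e \<in> R then fst p e else snd p e)"

lemma finite_signs: "finite E \<Longrightarrow> finite (signs E)"
  unfolding signs_def by (intro finite_PiE) auto

lemma signs_nonempty: "signs E \<noteq> {}"
  by (simp add: signs_def PiE_eq_empty_iff)

lemma sign_square: "\<theta> \<in> signs E \<Longrightarrow> e \<in> E \<Longrightarrow> \<theta> e * \<theta> e = 1"
  unfolding signs_def by (drule (1) PiE_mem) auto

lemma flip_signs: "R \<subseteq> E \<Longrightarrow> \<theta> \<in> signs E \<Longrightarrow> flip R \<theta> \<in> signs E"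
  unfolding signs_def by (auto simp: PiE_iff flip_def extensional_def split: if_splits)

lemma bij_flip: "R \<subseteq> E \<Longrightarrow> bij_betw (flip R) (signs E) (signs E)"
  by (rule bij_betw_byWitness[where f' = "flip R"]) (auto simp: flip_signs, auto simp: flip_def)

lemma bij_exchange: "bij_betw (exchange R) (signs E \<times> signs E) (signs E \<times> signs E)"
proof -
  have "exchange R ` (signs E \<times> signs E) \<subseteq> signs E \<times> signs E"
    by (fastforce simp: exchange_def signs_def PiE_iff extensional_def)
  moreover have "exchange R (exchange R p) = p" for p
    by (cases p) (auto simp: exchange_def fun_eq_iff)
  ultimately show ?thesis
    by (intro bij_betw_byWitness[where f' = "exchange R"]) auto
qed

text \<open>The map \<open>flip {x}\<close> preserves the average and changes the sign of the integrand.\<close>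

lemma average_sign_mult_eq_0:
  assumes "x \<in> E" and "\<And>\<theta>. f (flip {x} \<theta>) = f \<theta>"
  shows "average (signs E) (\<lambda>\<theta>. f \<theta> * \<theta> x) = 0"
proof -
  have "average (signs E) (\<lambda>\<theta>. f \<theta> * \<theta> x)
      = average (signs E) (\<lambda>\<theta>. f (flip {x} \<theta>) * flip {x} \<theta> x)"
    by (rule average_reindex[symmetric, OF bij_flip]) (use assms in auto)
  also have "\<dots> = average (signs E) (\<lambda>\<theta>. (-1) * (f \<theta> * \<theta> x))"
    by (intro average_cong) (simp add: assms flip_def)
  also have "\<dots> = - average (signs E) (\<lambda>\<theta>. f \<theta> * \<theta> x)"
    by (subst average_cmult) simp
  finally show ?thesis by simp
qed

lemma sum_flip_disjoint:
  "R \<inter> F = {} \<Longrightarrow> (\<Sum>e\<in>R. flip F \<theta> e * c e) = (\<Sum>e\<in>R. \<theta> e * c e)"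
  by (intro sum.cong) (auto simp: flip_def)

lemma second_moment:
  assumes "finite E" "R \<subseteq> E"
  shows "average (signs E) (\<lambda>\<theta>. (\<Sum>e\<in>R. \<theta> e * c e)\<^sup>2) = (\<Sum>e\<in>R. (c e)\<^sup>2)"
proof -
  have "finite R" using assms finite_subset by blast
  then show ?thesis using assms(2)
  proof (induction R rule: finite_induct)
    case empty
    then show ?case by (simp add: average_def)
  next
    case (insert x R)
    let ?S = "\<lambda>\<theta>. \<Sum>e\<in>R. \<theta> e * c e"
    have 0: "average (signs E) (\<lambda>\<theta>. ?S \<theta> * \<theta> x) = 0"
      by (rule average_sign_mult_eq_0) (use insert in \<open>auto simp: sum_flip_disjoint\<close>)
    have "average (signs E) (\<lambda>\<theta>. (\<Sum>e\<in>insert x R. \<theta> e * c e)\<^sup>2)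
        = average (signs E) (\<lambda>\<theta>. (?S \<theta>)\<^sup>2 + (2 * c x) * (?S \<theta> * \<theta> x) + (c x)\<^sup>2)"
    proof (rule average_cong)
      fix \<theta> assume "\<theta> \<in> signs E"
      then have sq: "\<theta> x * \<theta> x = 1" by (rule sign_square) (use insert.prems in simp)
      have binom: "(t * d + s)\<^sup>2 = s\<^sup>2 + (2 * d) * (s * t) + (t * t) * d\<^sup>2" for s t d :: real
        by (simp add: power2_eq_square algebra_simps)
      show "(\<Sum>e\<in>insert x R. \<theta> e * c e)\<^sup>2
          = (?S \<theta>)\<^sup>2 + (2 * c x) * (?S \<theta> * \<theta> x) + (c x)\<^sup>2"
        unfolding sum.insert[OF insert.hyps] binom sq by simp
    qed
    also have "\<dots> = (\<Sum>e\<in>insert x R. (c e)\<^sup>2)"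
      unfolding average_add average_cmult 0 average_const[OF finite_signs[OF assms(1)] signs_nonempty]
      using insert by simp
    finally show ?case .
  qed
qed

lemma fourth_moment_le:
  assumes "finite E" "R \<subseteq> E"
  shows "average (signs E) (\<lambda>\<theta>. (\<Sum>e\<in>R. \<theta> e * c e) ^ 4) \<le> 3 * (\<Sum>e\<in>R. (c e)\<^sup>2)\<^sup>2"
proof -
  have "finite R" using assms finite_subset by blast
  then show ?thesis using assms(2)
  proof (induction R rule: finite_induct)
    case empty
    then show ?case by (simp add: average_def)
  next
    case (insert x R)
    \<comment> \<open>Only the even powers of the new sign survive: \<open>E (S + \<epsilon> d)^4 = E S^4 + 6 d\<^sup>2 E S\<^sup>2 + d^4\<close>,
      which the induction hypothesis \<open>E S^4 \<le> 3 V\<^sup>2\<close> bounds by \<open>3 (V + d\<^sup>2)\<^sup>2\<close>, as \<open>E S\<^sup>2 = V\<close>.\<close>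
    let ?S = "\<lambda>\<theta>. \<Sum>e\<in>R. \<theta> e * c e" and ?V = "\<Sum>e\<in>R. (c e)\<^sup>2"
    have "average (signs E) (\<lambda>\<theta>. ?S \<theta> * \<theta> x) = 0" "average (signs E) (\<lambda>\<theta>. (?S \<theta>)^3 * \<theta> x) = 0"
      by (rule average_sign_mult_eq_0; use insert in \<open>auto simp: sum_flip_disjoint\<close>)+
    note odd = this
    have "average (signs E) (\<lambda>\<theta>. (\<Sum>e\<in>insert x R. \<theta> e * c e)^4)
        = average (signs E) (\<lambda>\<theta>. (?S \<theta>)^4 + (4 * c x) * ((?S \<theta>)^3 * \<theta> x)
            + (6 * (c x)\<^sup>2) * (?S \<theta>)\<^sup>2 + (4 * (c x)^3) * (?S \<theta> * \<theta> x) + (c x)^4)"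
    proof (rule average_cong)
      fix \<theta> assume "\<theta> \<in> signs E"
      then have sq: "\<theta> x * \<theta> x = 1" by (rule sign_square) (use insert.prems in simp)
      have binom: "(t * d + s)^4 = s^4 + (4 * d) * (s^3 * t) + (6 * d\<^sup>2) * s\<^sup>2 * (t * t)
          + (4 * d^3) * (s * t) * (t * t) + d^4 * ((t * t) * (t * t))" for s t d :: real
        by (simp add: power2_eq_square power3_eq_cube power4_eq_xxxx algebra_simps)
      show "(\<Sum>e\<in>insert x R. \<theta> e * c e)^4 = (?S \<theta>)^4 + (4 * c x) * ((?S \<theta>)^3 * \<theta> x)
            + (6 * (c x)\<^sup>2) * (?S \<theta>)\<^sup>2 + (4 * (c x)^3) * (?S \<theta> * \<theta> x) + (c x)^4"
        unfolding sum.insert[OF insert.hyps] binom sq by simp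
    qed
    also have "\<dots> = average (signs E) (\<lambda>\<theta>. (?S \<theta>)^4) + 6 * (c x)\<^sup>2 * ?V + (c x)^4"
      unfolding average_add average_cmult odd average_const[OF finite_signs[OF assms(1)] signs_nonempty]
      using insert.prems by (simp add: second_moment[OF assms(1)])
    also have "\<dots> \<le> 3 * ?V\<^sup>2 + 6 * (c x)\<^sup>2 * ?V + 3 * (c x)^4"
    proof -
      have "0 \<le> c x ^ 4" by simp
      moreover have "average (signs E) (\<lambda>\<theta>. (?S \<theta>)^4) \<le> 3 * ?V\<^sup>2"
        using insert.IH insert.prems by blast
      ultimately show ?thesis by linarith
    qed
    also have "\<dots> = 3 * (\<Sum>e\<in>insert x R. (c e)\<^sup>2)\<^sup>2"
      using insert.hyps by (simp add: power2_eq_square power4_eq_xxxx algebra_simps)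
    finally show ?case .
  qed
qed

lemma average_abs_le:
  assumes "finite E" "R \<subseteq> E"
  shows "average (signs E) (\<lambda>\<theta>. \<bar>\<Sum>e\<in>R. \<theta> e * c e\<bar>) \<le> sqrt (\<Sum>e\<in>R. (c e)\<^sup>2)"
proof (rule real_le_rsqrt)
  show "(average (signs E) (\<lambda>\<theta>. \<bar>\<Sum>e\<in>R. \<theta> e * c e\<bar>))\<^sup>2 \<le> (\<Sum>e\<in>R. (c e)\<^sup>2)"
    using power2_average_le[OF finite_signs[OF assms(1)] signs_nonempty,
        where f = "\<lambda>\<theta>. \<bar>\<Sum>e\<in>R. \<theta> e * c e\<bar>"] second_moment[OF assms, of c]
    by simp
qed

text \<open>
  The first moment is recovered from the second and the fourth: \<open>12 \<sigma>\<^sup>2 x\<^sup>2 - x^4 \<le> 16 \<sigma>\<^sup>3 \<bar>x\<bar>\<close> for all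
  \<open>x\<close>, and the left-hand side has mean at least \<open>(12 - 3) \<sigma>^4\<close> at \<open>x = \<Sum>e. \<theta> e * c e\<close>. Touching the
  curve at \<open>x = 2 \<sigma>\<close> keeps the constant rational; touching at \<open>\<surd>3 \<sigma>\<close> would improve \<open>9/16\<close> to \<open>1/\<surd>3\<close>.
\<close>

lemma khintchine_L1_lower:
  assumes "finite E" "R \<subseteq> E"
  shows "9/16 * sqrt (\<Sum>e\<in>R. (c e)\<^sup>2) \<le> average (signs E) (\<lambda>\<theta>. \<bar>\<Sum>e\<in>R. \<theta> e * c e\<bar>)"
proof -
  let ?S = "\<lambda>\<theta>. \<Sum>e\<in>R. \<theta> e * c e"
  define \<sigma> where "\<sigma> = sqrt (\<Sum>e\<in>R. (c e)\<^sup>2)"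
  have \<sigma>0: "0 \<le> \<sigma>" and \<sigma>2: "(\<Sum>e\<in>R. (c e)\<^sup>2) = \<sigma>\<^sup>2"
    by (auto simp: \<sigma>_def sum_nonneg)
  have key: "12 * \<sigma>\<^sup>2 * x\<^sup>2 - x^4 \<le> 16 * \<sigma>^3 * \<bar>x\<bar>" for x :: real
  proof -
    have "0 \<le> \<bar>x\<bar> * ((\<bar>x\<bar> - 2 * \<sigma>)\<^sup>2 * (\<bar>x\<bar> + 4 * \<sigma>))"
      using \<sigma>0 by simp
    also have "\<dots> = \<bar>x\<bar>^4 - 12 * \<sigma>\<^sup>2 * \<bar>x\<bar>\<^sup>2 + 16 * \<sigma>^3 * \<bar>x\<bar>"
      by (simp add: power2_eq_square power3_eq_cube power4_eq_xxxx algebra_simps)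
    finally show ?thesis by simp
  qed
  have "9 * \<sigma>^4 = 12 * \<sigma>\<^sup>2 * \<sigma>\<^sup>2 - 3 * (\<sigma>\<^sup>2)\<^sup>2"
    by (simp add: power2_eq_square power4_eq_xxxx)
  also have "\<dots> \<le> 12 * \<sigma>\<^sup>2 * average (signs E) (\<lambda>\<theta>. (?S \<theta>)\<^sup>2) - average (signs E) (\<lambda>\<theta>. (?S \<theta>)^4)"
    using fourth_moment_le[OF assms, of c] second_moment[OF assms, of c] \<sigma>2 by simp
  also have "\<dots> = average (signs E) (\<lambda>\<theta>. 12 * \<sigma>\<^sup>2 * (?S \<theta>)\<^sup>2 - (?S \<theta>)^4)"
    by (simp add: average_diff average_cmult)
  also have "\<dots> \<le> average (signs E) (\<lambda>\<theta>. 16 * \<sigma>^3 * \<bar>?S \<theta>\<bar>)"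
    by (intro average_mono key)
  also have "\<dots> = 16 * \<sigma>^3 * average (signs E) (\<lambda>\<theta>. \<bar>?S \<theta>\<bar>)"
    by (rule average_cmult)
  finally have *: "9 * \<sigma>^4 \<le> 16 * \<sigma>^3 * average (signs E) (\<lambda>\<theta>. \<bar>?S \<theta>\<bar>)" .
  show ?thesis
  proof (cases "\<sigma> = 0")
    case True
    have "0 \<le> average (signs E) (\<lambda>\<theta>. \<bar>?S \<theta>\<bar>)"
      unfolding average_def by (intro divide_nonneg_nonneg sum_nonneg) auto
    with True show ?thesis by (simp add: \<sigma>_def)
  next
    case False
    have "\<sigma>^3 * (9 * \<sigma>) \<le> \<sigma>^3 * (16 * average (signs E) (\<lambda>\<theta>. \<bar>?S \<theta>\<bar>))"
      using * by (simp add: power3_eq_cube power4_eq_xxxx algebra_simps)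
    then have "9 * \<sigma> \<le> 16 * average (signs E) (\<lambda>\<theta>. \<bar>?S \<theta>\<bar>)"
      using False \<sigma>0 by (simp add: mult_le_cancel_left)
    then show ?thesis by (simp add: \<sigma>_def)
  qed
qed

text \<open>
  The positive coordinates of \<open>\<epsilon>\<close> form a uniformly random subset of \<open>V\<close>. The sums over this subset and
  over its complement are equally distributed and differ by a Rademacher sum, so the mean absolute
  value of one of them is at least half of that of the Rademacher sum.
\<close>

lemma khintchine_L1_lower_subsets:
  assumes "finite V"
  shows "9/32 * sqrt (\<Sum>i\<in>V. (c i)\<^sup>2)
    \<le> average (signs V) (\<lambda>\<epsilon>. \<bar>\<Sum>i | i \<in> V \<and> \<epsilon> i = 1. c i\<bar>)"
proof -
  let ?H = "\<lambda>\<epsilon>. \<Sum>i | i \<in> V \<and> \<epsilon> i = 1. c i" and ?S = "\<lambda>\<epsilon>. \<Sum>i\<in>V. \<epsilon> i * c i"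
  have diff: "?H \<epsilon> - ?H (flip V \<epsilon>) = ?S \<epsilon>" if "\<epsilon> \<in> signs V" for \<epsilon>
  proof -
    have "?H \<epsilon> - ?H (flip V \<epsilon>)
        = (\<Sum>i\<in>V. (if \<epsilon> i = 1 then c i else 0) - (if flip V \<epsilon> i = 1 then c i else 0))"
      using assms by (simp add: sum_subtractf flip: sum.inter_filter)
    also have "\<dots> = ?S \<epsilon>"
    proof (rule sum.cong)
      fix i assume "i \<in> V"
      then have "\<epsilon> i = -1 \<or> \<epsilon> i = 1" using that unfolding signs_def by (auto dest!: PiE_mem)
      then show "(if \<epsilon> i = 1 then c i else 0) - (if flip V \<epsilon> i = 1 then c i else 0) = \<epsilon> i * c i"
        using \<open>i \<in> V\<close> by (auto simp: flip_def)
    qed simp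
    finally show ?thesis .
  qed
  have "9/16 * sqrt (\<Sum>i\<in>V. (c i)\<^sup>2) \<le> average (signs V) (\<lambda>\<epsilon>. \<bar>?S \<epsilon>\<bar>)"
    by (rule khintchine_L1_lower[OF assms]) simp
  also have "\<dots> \<le> average (signs V) (\<lambda>\<epsilon>. \<bar>?H \<epsilon>\<bar> + \<bar>?H (flip V \<epsilon>)\<bar>)"
  proof (rule average_mono)
    fix \<epsilon> assume "\<epsilon> \<in> signs V"
    then show "\<bar>?S \<epsilon>\<bar> \<le> \<bar>?H \<epsilon>\<bar> + \<bar>?H (flip V \<epsilon>)\<bar>"
      using diff[of \<epsilon>] by linarith
  qed
  also have "\<dots> = 2 * average (signs V) (\<lambda>\<epsilon>. \<bar>?H \<epsilon>\<bar>)"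
    using average_reindex[OF bij_flip[OF order_refl], of V "\<lambda>\<epsilon>. \<bar>?H \<epsilon>\<bar>"]
    by (simp add: average_add)
  finally show ?thesis by simp
qed

section \<open>The lower bound for every colouring\<close>

definition block_sum :: "('v \<Rightarrow> 'v \<Rightarrow> real) \<Rightarrow> 'v set \<Rightarrow> 'v set \<Rightarrow> real" where
  "block_sum w A B = (\<Sum>j\<in>B. \<Sum>i\<in>A. w i j)"

lemma block_sum_Un_left:
  "finite A \<Longrightarrow> finite A' \<Longrightarrow> A \<inter> A' = {} \<Longrightarrow>
    block_sum w (A \<union> A') B = block_sum w A B + block_sum w A' B"
  unfolding block_sum_def by (simp add: sum.union_disjoint sum.distrib)

lemma block_sum_Un_right:
  "finite B \<Longrightarrow> finite B' \<Longrightarrow> B \<inter> B' = {} \<Longrightarrow>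
    block_sum w A (B \<union> B') = block_sum w A B + block_sum w A B'"
  unfolding block_sum_def by (simp add: sum.union_disjoint)

lemma block_sum_commute:
  assumes "\<And>i j. w i j = w j i"
  shows "block_sum w A B = block_sum w B A"
  unfolding block_sum_def by (subst sum.swap) (intro sum.cong refl assms)

text \<open>
  With \<open>P = A - B\<close>, \<open>M = A \<inter> B\<close> and \<open>R = B - A\<close>, both sides expand to the same combination of blocks.
  Allowing \<open>A\<close> and \<open>B\<close> to overlap means that the random set \<open>A\<close> below need not be kept away from the
  column under consideration.
\<close>

lemma block_sum_polarization:
  assumes "finite A" "finite B" and sym: "\<And>i j. w i j = w j i"
  shows "2 * block_sum w A B = block_sum w (A \<union> B) (A \<union> B) + block_sum w (A \<inter> B) (A \<inter> B)
    - block_sum w (A - B) (A - B) - block_sum w (B - A) (B - A)"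
proof -
  define P M R where "P = A - B" and "M = A \<inter> B" and "R = B - A"
  have fin: "finite P" "finite M" "finite R" using assms by (auto simp: P_def M_def R_def)
  have dis: "P \<inter> M = {}" "R \<inter> M = {}" "P \<inter> R = {}" "(P \<union> M) \<inter> R = {}"
    by (auto simp: P_def M_def R_def)
  have eq: "A = P \<union> M" "B = R \<union> M" "A \<union> B = (P \<union> M) \<union> R"
    by (auto simp: P_def M_def R_def)
  have comm: "block_sum w M P = block_sum w P M" "block_sum w R P = block_sum w P R"
    "block_sum w R M = block_sum w M R"
    by (rule block_sum_commute[OF sym])+
  have "block_sum w (P \<union> M) (R \<union> M)
      = block_sum w P R + block_sum w M R + (block_sum w P M + block_sum w M M)"
    by (simp only: block_sum_Un_left block_sum_Un_right fin dis)
  moreover have "block_sum w ((P \<union> M) \<union> R) ((P \<union> M) \<union> R)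
      = block_sum w P P + block_sum w P M + (block_sum w P M + block_sum w M M)
        + (block_sum w P R + block_sum w M R) + (block_sum w P R + block_sum w M R + block_sum w R R)"
    by (simp only: block_sum_Un_left block_sum_Un_right fin dis comm finite_UnI algebra_simps)
  ultimately have "2 * block_sum w (P \<union> M) (R \<union> M)
      = block_sum w ((P \<union> M) \<union> R) ((P \<union> M) \<union> R) + block_sum w M M - block_sum w P P - block_sum w R R"
    by linarith
  then show ?thesis
    unfolding eq(3) P_def[symmetric] M_def[symmetric] R_def[symmetric] eq(1)[symmetric] eq(2)[symmetric] .
qed

text \<open>
  Here \<open>\<bar>block_sum w I I\<bar> \<le> 2 * D\<close> because the full symmetric sum counts every edge twice. The constant is
  \<open>9/32\<close> from Khintchine's inequality divided by the \<open>8\<close> from two blocks of size at most \<open>4 D\<close>.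
\<close>

lemma sum_column_norms_le:
  fixes w :: "'v \<Rightarrow> 'v \<Rightarrow> real"
  assumes fin: "finite V" and sym: "\<And>i j. w i j = w j i"
    and D: "\<And>I. I \<subseteq> V \<Longrightarrow> \<bar>block_sum w I I\<bar> \<le> 2 * D"
  shows "9/256 * (\<Sum>j\<in>V. sqrt (\<Sum>i\<in>V. (w i j)\<^sup>2)) \<le> D"
proof -
  have bil: "\<bar>block_sum w A B\<bar> \<le> 4 * D" if "A \<subseteq> V" "B \<subseteq> V" for A B
  proof -
    have fins: "finite A" "finite B" using that[THEN finite_subset, OF fin] .
    have subs: "A \<union> B \<subseteq> V" "A \<inter> B \<subseteq> V" "A - B \<subseteq> V" "B - A \<subseteq> V"
      using that by auto
    have "2 * block_sum w A B = block_sum w (A \<union> B) (A \<union> B) + block_sum w (A \<inter> B) (A \<inter> B)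
        - block_sum w (A - B) (A - B) - block_sum w (B - A) (B - A)"
      by (rule block_sum_polarization[OF fins sym])
    then show ?thesis using subs[THEN D] by linarith
  qed
  have abs: "(\<Sum>j\<in>V. \<bar>\<Sum>i\<in>A. w i j\<bar>) \<le> 8 * D" if "A \<subseteq> V" for A
  proof -
    let ?c = "\<lambda>j. \<Sum>i\<in>A. w i j"
    have "(\<Sum>j\<in>V. \<bar>?c j\<bar>) = (\<Sum>j\<in>V. (if 0 < ?c j then ?c j else 0) - (if \<not> 0 < ?c j then ?c j else 0))"
      by (intro sum.cong) auto
    also have "\<dots> = block_sum w A {j \<in> V. 0 < ?c j} - block_sum w A {j \<in> V. \<not> 0 < ?c j}"
      unfolding block_sum_def using fin by (simp only: sum_subtractf sum.inter_filter)
    also have "\<dots> \<le> 8 * D"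
      using bil[OF that, of "{j \<in> V. 0 < ?c j}"] bil[OF that, of "{j \<in> V. \<not> 0 < ?c j}"] by auto
    finally show ?thesis .
  qed
  have "9/32 * (\<Sum>j\<in>V. sqrt (\<Sum>i\<in>V. (w i j)\<^sup>2))
      \<le> (\<Sum>j\<in>V. average (signs V) (\<lambda>\<epsilon>. \<bar>\<Sum>i | i \<in> V \<and> \<epsilon> i = 1. w i j\<bar>))"
    unfolding sum_distrib_left by (intro sum_mono khintchine_L1_lower_subsets fin)
  also have "\<dots> = average (signs V) (\<lambda>\<epsilon>. \<Sum>j\<in>V. \<bar>\<Sum>i | i \<in> V \<and> \<epsilon> i = 1. w i j\<bar>)"
    by (rule average_sum[symmetric])
  also have "\<dots> \<le> average (signs V) (\<lambda>_. 8 * D)"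
    by (intro average_mono abs) auto
  also have "\<dots> = 8 * D"
    by (simp add: average_const finite_signs fin signs_nonempty)
  finally show ?thesis by simp
qed

section \<open>Contraction of the rows\<close>

definition independent_of :: "'e set \<Rightarrow> (('e \<Rightarrow> real) \<Rightarrow> 'b) \<Rightarrow> bool" where
  "independent_of R u \<longleftrightarrow> (\<forall>\<theta> \<theta>'. (\<forall>e. e \<notin> R \<longrightarrow> \<theta> e = \<theta>' e) \<longrightarrow> u \<theta> = u \<theta>')"

lemma independent_ofD:
  "independent_of R u \<Longrightarrow> (\<And>e. e \<notin> R \<Longrightarrow> \<theta> e = \<theta>' e) \<Longrightarrow> u \<theta> = u \<theta>'"
  unfolding independent_of_def by blast

text \<open>
  One row \<open>R\<close> with sums \<open>Z \<theta> t\<close>, in the presence of a term \<open>u\<close> that the other coordinates determine. The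
  expected value of \<open>\<bar>Z \<theta> t\<bar>\<close> costs \<open>r\<close>, and the fluctuation \<open>\<bar>Z \<theta> t\<bar> - \<bar>Z \<theta>' t\<bar>\<close> against an independent copy
  is antisymmetric under exchanging the row between \<open>\<theta>\<close> and \<open>\<theta>'\<close>. Adding its maximum, attained at \<open>s\<close>,
  to that of its negative, attained at \<open>t\<close>, leaves only differences of absolute values at \<open>s\<close> and
  \<open>t\<close>; these are at most \<open>\<bar>Z s - Z t\<bar>\<close> for each copy. Maximizing over pairs \<open>(s, t)\<close> then removes the
  absolute value, because \<open>s\<close> and \<open>t\<close> may be interchanged, and the two resulting maxima of
  \<open>u + 2 Z\<close> and \<open>u - 2 Z\<close> are equally distributed by the sign symmetry of the row.
\<close>

lemma average_Max_abs_le: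
  fixes u :: "('e \<Rightarrow> real) \<Rightarrow> 't \<Rightarrow> real"
  assumes E: "finite E" "R \<subseteq> E" and T: "finite T" "T \<noteq> {}"
    and u: "independent_of R u"
    and r: "\<And>t. t \<in> T \<Longrightarrow> sqrt (\<Sum>e\<in>R. (c e t)\<^sup>2) \<le> r"
  shows "average (signs E) (\<lambda>\<theta>. MAX t\<in>T. u \<theta> t + \<bar>\<Sum>e\<in>R. \<theta> e * c e t\<bar>)
    \<le> r + average (signs E) (\<lambda>\<theta>. MAX t\<in>T. u \<theta> t + 2 * (\<Sum>e\<in>R. \<theta> e * c e t))"
proof -
  define Z where "Z \<theta> t = (\<Sum>e\<in>R. \<theta> e * c e t)" for \<theta> t
  define G where "G \<theta> \<theta>' = (MAX t\<in>T. u \<theta> t + \<bar>Z \<theta> t\<bar> - \<bar>Z \<theta>' t\<bar>)" for \<theta> \<theta>'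
  define G' where "G' \<theta> \<theta>' = (MAX t\<in>T. u \<theta> t + \<bar>Z \<theta>' t\<bar> - \<bar>Z \<theta> t\<bar>)" for \<theta> \<theta>'
  define H where "H \<theta> \<theta>' = (MAX p\<in>T\<times>T. u \<theta> (fst p) + u \<theta> (snd p) + 2 * \<bar>Z \<theta>' (fst p) - Z \<theta>' (snd p)\<bar>)"
    for \<theta> \<theta>'
  define K where "K \<theta> = (MAX t\<in>T. u \<theta> t + 2 * Z \<theta> t)" for \<theta>
  let ?av = "average (signs E)" and ?av2 = "average (signs E \<times> signs E)"
  have TT: "finite (T \<times> T)" "T \<times> T \<noteq> {}" using T by auto
  have ex_u: "u (fst (exchange R p)) = u (fst p)" for p
    by (rule independent_ofD[OF u]) (auto simp: exchange_def)
  have ex_Z: "Z (fst (exchange R p)) = Z (snd p)" "Z (snd (exchange R p)) = Z (fst p)" for p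
    by (auto simp: Z_def exchange_def fun_eq_iff intro!: sum.cong)
  have fl_u: "u (flip R \<theta>) = u \<theta>" for \<theta>
    by (rule independent_ofD[OF u]) (auto simp: flip_def)
  have fl_Z: "Z (flip R \<theta>) t = - Z \<theta> t" for \<theta> t
    by (auto simp: Z_def flip_def sum_negf[symmetric] intro!: sum.cong)

  \<comment> \<open>Jensen's inequality: a maximum of averages is at most the average of the maxima.\<close>
  have center: "(MAX t\<in>T. u \<theta> t + \<bar>Z \<theta> t\<bar>) \<le> r + ?av (G \<theta>)" for \<theta>
  proof (rule Max.boundedI)
    fix x assume "x \<in> (\<lambda>t. u \<theta> t + \<bar>Z \<theta> t\<bar>) ` T"
    then obtain t where t: "t \<in> T" and x: "x = u \<theta> t + \<bar>Z \<theta> t\<bar>" by auto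
    have "?av (\<lambda>\<theta>'. \<bar>Z \<theta>' t\<bar>) \<le> r"
      using average_abs_le[OF E, of "\<lambda>e. c e t"] r[OF t] by (simp add: Z_def)
    then have "x \<le> r + ?av (\<lambda>\<theta>'. (u \<theta> t + \<bar>Z \<theta> t\<bar>) - \<bar>Z \<theta>' t\<bar>)"
      by (simp add: x average_diff average_const finite_signs E signs_nonempty)
    also have "\<dots> \<le> r + ?av (G \<theta>)"
      using T t by (intro add_left_mono average_mono) (auto simp: G_def)
    finally show "x \<le> r + ?av (G \<theta>)" .
  qed (use T in auto)

  have pair: "G \<theta> \<theta>' + G' \<theta> \<theta>' \<le> (H \<theta> \<theta> + H \<theta> \<theta>') / 2" for \<theta> \<theta>'
  proof -
    have "G \<theta> \<theta>' \<in> (\<lambda>t. u \<theta> t + \<bar>Z \<theta> t\<bar> - \<bar>Z \<theta>' t\<bar>) ` T"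
      unfolding G_def using T by (intro Max_in) auto
    then obtain s where s: "s \<in> T" "G \<theta> \<theta>' = u \<theta> s + \<bar>Z \<theta> s\<bar> - \<bar>Z \<theta>' s\<bar>" by auto
    have "G' \<theta> \<theta>' \<in> (\<lambda>t. u \<theta> t + \<bar>Z \<theta>' t\<bar> - \<bar>Z \<theta> t\<bar>) ` T"
      unfolding G'_def using T by (intro Max_in) auto
    then obtain t where t: "t \<in> T" "G' \<theta> \<theta>' = u \<theta> t + \<bar>Z \<theta>' t\<bar> - \<bar>Z \<theta> t\<bar>" by auto
    have H: "u \<theta> s + u \<theta> t + 2 * \<bar>Z \<theta>'' s - Z \<theta>'' t\<bar> \<le> H \<theta> \<theta>''" for \<theta>''
      unfolding H_def using TT s t
      by (intro Max_ge) (auto intro!: image_eqI[where x = "(s, t)"])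
    have "\<bar>Z \<theta> s\<bar> \<le> \<bar>Z \<theta> t\<bar> + \<bar>Z \<theta> s - Z \<theta> t\<bar>"
      "\<bar>Z \<theta>' t\<bar> \<le> \<bar>Z \<theta>' s\<bar> + \<bar>Z \<theta>' s - Z \<theta>' t\<bar>"
      by linarith+
    moreover have "(x + v - v') + (y + w' - w) \<le> (h + h') / 2"
      if "v \<le> w + p" "w' \<le> v' + q" "x + y + 2 * p \<le> h" "x + y + 2 * q \<le> h'"
      for x y v w v' w' p q h h' :: real
      using that by argo
    ultimately show ?thesis
      unfolding s(2) t(2) using H[of \<theta>] H[of \<theta>'] by blast
  qed

  have split: "H \<theta> \<theta> \<le> K \<theta> + K (flip R \<theta>)" for \<theta>
    unfolding H_def
  proof (rule Max.boundedI)
    fix x assume "x \<in> (\<lambda>p. u \<theta> (fst p) + u \<theta> (snd p) + 2 * \<bar>Z \<theta> (fst p) - Z \<theta> (snd p)\<bar>) ` (T \<times> T)"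
    then obtain s t where st: "s \<in> T" "t \<in> T"
      and x: "x = u \<theta> s + u \<theta> t + 2 * \<bar>Z \<theta> s - Z \<theta> t\<bar>" by auto
    have K: "u \<theta> v + 2 * Z \<theta> v \<le> K \<theta>" "u \<theta> v - 2 * Z \<theta> v \<le> K (flip R \<theta>)" if "v \<in> T" for v
      unfolding K_def using T that by (auto simp: fl_u fl_Z intro!: Max_ge)
    show "x \<le> K \<theta> + K (flip R \<theta>)"
      using K[OF st(1)] K[OF st(2)] x by argo
  qed (use TT in auto)

  \<comment> \<open>Exchanging the row turns \<open>G\<close> into \<open>G'\<close>, and moves both arguments of \<open>H\<close> to the same vector.\<close>
  have "?av2 (\<lambda>p. G (fst p) (snd p)) = ?av2 (\<lambda>p. G' (fst p) (snd p))"
    by (subst average_reindex[OF bij_exchange[of R], symmetric]) (simp add: G_def G'_def ex_u ex_Z)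
  moreover have "?av2 (\<lambda>p. H (fst p) (snd p)) = ?av2 (\<lambda>p. H (fst p) (fst p))"
    by (subst average_reindex[OF bij_exchange[of R], symmetric]) (simp add: H_def ex_u ex_Z)
  moreover have "?av2 (\<lambda>p. G (fst p) (snd p) + G' (fst p) (snd p))
      \<le> ?av2 (\<lambda>p. 1/2 * (H (fst p) (fst p) + H (fst p) (snd p)))"
    by (intro average_mono) (use pair in simp)
  ultimately have "2 * ?av2 (\<lambda>p. G (fst p) (snd p)) \<le> ?av2 (\<lambda>p. H (fst p) (fst p))"
    unfolding average_cmult average_add by simp
  then have GH: "2 * ?av (\<lambda>\<theta>. ?av (G \<theta>)) \<le> ?av (\<lambda>\<theta>. H \<theta> \<theta>)"
    using average_pairs[of "signs E" G] average_pairs[of "signs E" "\<lambda>\<theta> _. H \<theta> \<theta>"]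
    by (simp add: average_const finite_signs E signs_nonempty)

  have "?av (\<lambda>\<theta>. H \<theta> \<theta>) \<le> ?av (\<lambda>\<theta>. K \<theta> + K (flip R \<theta>))"
    by (intro average_mono split)
  also have "\<dots> = 2 * ?av K"
    by (simp add: average_add average_reindex[OF bij_flip[OF E(2)]])
  finally have "?av (\<lambda>\<theta>. ?av (G \<theta>)) \<le> ?av K" using GH by simp
  moreover have "?av (\<lambda>\<theta>. MAX t\<in>T. u \<theta> t + \<bar>Z \<theta> t\<bar>) \<le> ?av (\<lambda>\<theta>. r + ?av (G \<theta>))"
    by (intro average_mono center)
  ultimately have "?av (\<lambda>\<theta>. MAX t\<in>T. u \<theta> t + \<bar>Z \<theta> t\<bar>) \<le> r + ?av K"
    by (simp add: average_add average_const finite_signs E signs_nonempty)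
  then show ?thesis by (simp add: Z_def K_def[abs_def])
qed

text \<open>
  The rows are treated one at a time: the absolute values still present and the linear terms already
  produced belong to other rows, so they are absorbed into \<open>u\<close>. This is why \<open>u\<close> is arbitrary.
\<close>

lemma average_Max_sum_abs_le:
  fixes u :: "('e \<Rightarrow> real) \<Rightarrow> 't \<Rightarrow> real"
  assumes E: "finite E" and T: "finite T" "T \<noteq> {}" and "finite X"
    and "\<And>k. k \<in> X \<Longrightarrow> R k \<subseteq> E" and "disjoint_family_on R X"
    and "independent_of (\<Union>k\<in>X. R k) u"
    and "\<And>k t. k \<in> X \<Longrightarrow> t \<in> T \<Longrightarrow> sqrt (\<Sum>e\<in>R k. (c e t)\<^sup>2) \<le> r k"
  shows "average (signs E) (\<lambda>\<theta>. MAX t\<in>T. u \<theta> t + (\<Sum>k\<in>X. \<bar>\<Sum>e\<in>R k. \<theta> e * c e t\<bar>))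
    \<le> (\<Sum>k\<in>X. r k)
      + average (signs E) (\<lambda>\<theta>. MAX t\<in>T. u \<theta> t + (\<Sum>k\<in>X. 2 * (\<Sum>e\<in>R k. \<theta> e * c e t)))"
  using assms(4-)
proof (induction X arbitrary: u rule: finite_induct)
  case empty
  then show ?case by simp
next
  case (insert k X)
  let ?Z = "\<lambda>k \<theta> t. \<Sum>e\<in>R k. \<theta> e * c e t"
  have disj: "R k \<inter> R l = {}" if "l \<in> X" for l
    using insert.prems(2) insert.hyps(2) that by (auto simp: disjoint_family_on_def)
  have Z_cong: "?Z l \<theta> t = ?Z l \<theta>' t" if "\<And>e. e \<in> R l \<Longrightarrow> \<theta> e = \<theta>' e" for l t and \<theta> \<theta>' :: "'e \<Rightarrow> real"
    using that by (intro sum.cong) auto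
  have u_cong: "u \<theta> = u \<theta>'" if "\<And>e. e \<notin> R k \<Longrightarrow> e \<notin> (\<Union>l\<in>X. R l) \<Longrightarrow> \<theta> e = \<theta>' e"
    for \<theta> \<theta>'
    by (rule independent_ofD[OF insert.prems(3)]) (use that in auto)
  have "average (signs E) (\<lambda>\<theta>. MAX t\<in>T. u \<theta> t + (\<Sum>l\<in>insert k X. \<bar>?Z l \<theta> t\<bar>))
      = average (signs E) (\<lambda>\<theta>. MAX t\<in>T. (u \<theta> t + (\<Sum>l\<in>X. \<bar>?Z l \<theta> t\<bar>)) + \<bar>?Z k \<theta> t\<bar>)"
    using insert.hyps by (simp add: algebra_simps)
  also have "\<dots> \<le> r k + average (signs E)
      (\<lambda>\<theta>. MAX t\<in>T. (u \<theta> t + (\<Sum>l\<in>X. \<bar>?Z l \<theta> t\<bar>)) + 2 * ?Z k \<theta> t)"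
  proof (rule average_Max_abs_le[OF E _ T])
    show "independent_of (R k) (\<lambda>\<theta> t. u \<theta> t + (\<Sum>l\<in>X. \<bar>?Z l \<theta> t\<bar>))"
      unfolding independent_of_def
    proof (intro allI impI ext)
      fix \<theta> \<theta>' :: "'e \<Rightarrow> real" and t assume "\<forall>e. e \<notin> R k \<longrightarrow> \<theta> e = \<theta>' e"
      then have "u \<theta> = u \<theta>'" "\<And>l. l \<in> X \<Longrightarrow> ?Z l \<theta> t = ?Z l \<theta>' t"
        using disj by (auto intro!: u_cong Z_cong)
      then show "u \<theta> t + (\<Sum>l\<in>X. \<bar>?Z l \<theta> t\<bar>) = u \<theta>' t + (\<Sum>l\<in>X. \<bar>?Z l \<theta>' t\<bar>)" by simp
    qed
  qed (use insert.prems in auto)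
  also have "average (signs E) (\<lambda>\<theta>. MAX t\<in>T. (u \<theta> t + (\<Sum>l\<in>X. \<bar>?Z l \<theta> t\<bar>)) + 2 * ?Z k \<theta> t)
     = average (signs E) (\<lambda>\<theta>. MAX t\<in>T. (u \<theta> t + 2 * ?Z k \<theta> t) + (\<Sum>l\<in>X. \<bar>?Z l \<theta> t\<bar>))"
    by (simp add: algebra_simps)
  also have "\<dots> \<le> (\<Sum>l\<in>X. r l) + average (signs E)
      (\<lambda>\<theta>. MAX t\<in>T. (u \<theta> t + 2 * ?Z k \<theta> t) + (\<Sum>l\<in>X. 2 * ?Z l \<theta> t))"
  proof (rule insert.IH)
    show "independent_of (\<Union>l\<in>X. R l) (\<lambda>\<theta> t. u \<theta> t + 2 * ?Z k \<theta> t)"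
      unfolding independent_of_def
    proof (intro allI impI ext)
      fix \<theta> \<theta>' :: "'e \<Rightarrow> real" and t assume "\<forall>e. e \<notin> (\<Union>l\<in>X. R l) \<longrightarrow> \<theta> e = \<theta>' e"
      then have "u \<theta> = u \<theta>'" "?Z k \<theta> t = ?Z k \<theta>' t"
        using disj by (auto intro!: u_cong Z_cong)
      then show "u \<theta> t + 2 * ?Z k \<theta> t = u \<theta>' t + 2 * ?Z k \<theta>' t" by simp
    qed
  qed (use insert.prems in \<open>auto simp: disjoint_family_on_def\<close>)
  finally show ?case
    using insert.hyps by (simp add: algebra_simps)
qed

section \<open>Discrepancy of the weighted complete graph\<close>

lemma colorings_eq_signs: "colorings n = signs (edges n)"
  by (simp add: colorings_def signs_def)

lemma expected_disc_eq_average_signs: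
  "expected_disc n a = average (signs (edges n)) (disc_coloring n a)"
  by (simp add: expected_disc_eq_average average_def colorings_eq_signs)

lemma disc_le_expected_disc: "disc n a \<le> expected_disc n a"
proof -
  have "disc n a = average (signs (edges n)) (\<lambda>_. disc n a)"
    by (simp add: average_const finite_signs finite_edges signs_nonempty)
  also have "\<dots> \<le> average (signs (edges n)) (disc_coloring n a)"
    by (intro average_mono)
      (auto simp: disc_def colorings_eq_signs finite_signs finite_edges)
  finally show ?thesis by (simp add: expected_disc_eq_average_signs)
qed

lemma abs_sum_le_disc_coloring:
  assumes "I \<subseteq> {1..n}"
  shows "\<bar>\<Sum>e | e \<in> edges n \<and> fst e \<in> I \<and> snd e \<in> I. \<theta> e * a e\<bar> \<le> disc_coloring n a \<theta>"
  unfolding disc_coloring_def using assms by (intro Max_ge) auto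

text \<open>
  Each row of the upper triangular array of weights is part of a column of the symmetrized matrix \<open>w\<close>, and
  so is each column; hence the column norms of \<open>w\<close> dominate both sums in \<open>Q\<close>.
\<close>

lemma Q_le_disc_coloring:
  assumes \<theta>: "\<theta> \<in> colorings n"
  shows "9/256 * Q n a \<le> disc_coloring n a \<theta>"
proof -
  define b where "b e = \<theta> e * a e" for e
  define w where "w i j = (if i < j then b (i, j) else if j < i then b (j, i) else 0)" for i j
  have b2: "(b (i, j))\<^sup>2 = (a (i, j))\<^sup>2" if "1 \<le> i" "i < j" "j \<le> n" for i j
  proof -
    have "\<theta> (i, j) * \<theta> (i, j) = 1"
      using that \<theta> by (intro sign_square[of _ "edges n"]) (auto simp: colorings_eq_signs edges_def)
    then show ?thesis by (simp add: b_def power_mult_distrib power2_eq_square)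
  qed
  have "9/256 * (\<Sum>j\<in>{1..n}. sqrt (\<Sum>i\<in>{1..n}. (w i j)\<^sup>2)) \<le> disc_coloring n a \<theta>"
  proof (rule sum_column_norms_le)
    fix I assume I: "I \<subseteq> {1..n}"
    then have fin: "finite I" using finite_subset by blast
    let ?U = "\<lambda>i j. if i < j then b (i, j) else 0"
    have "(\<Sum>e | e \<in> edges n \<and> fst e \<in> I \<and> snd e \<in> I. \<theta> e * a e)
        = (\<Sum>e\<in>{e \<in> I \<times> I. fst e < snd e}. b e)"
      unfolding b_def using I by (intro sum.cong) (auto simp: edges_def)
    also have "\<dots> = (\<Sum>i\<in>I. \<Sum>j\<in>I. ?U i j)"
      using fin by (simp add: sum.inter_filter sum.cartesian_product')
    finally have half: "(\<Sum>e | e \<in> edges n \<and> fst e \<in> I \<and> snd e \<in> I. \<theta> e * a e)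
        = (\<Sum>i\<in>I. \<Sum>j\<in>I. ?U i j)" .
    have "block_sum w I I = (\<Sum>j\<in>I. \<Sum>i\<in>I. ?U i j + ?U j i)"
      unfolding block_sum_def w_def by (intro sum.cong) auto
    also have "\<dots> = (\<Sum>j\<in>I. \<Sum>i\<in>I. ?U i j) + (\<Sum>i\<in>I. \<Sum>j\<in>I. ?U i j)"
      by (simp add: sum.distrib)
    also have "(\<Sum>j\<in>I. \<Sum>i\<in>I. ?U i j) = (\<Sum>i\<in>I. \<Sum>j\<in>I. ?U i j)"
      by (rule sum.swap)
    finally show "\<bar>block_sum w I I\<bar> \<le> 2 * disc_coloring n a \<theta>"
      using abs_sum_le_disc_coloring[OF I, of \<theta> a] half by simp
  qed (auto simp: w_def)
  moreover have "Q n a \<le> (\<Sum>j\<in>{1..n}. sqrt (\<Sum>i\<in>{1..n}. (w i j)\<^sup>2))"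
    unfolding Q_def
  proof (rule max.boundedI)
    have "(\<Sum>i = 1..n - 1. sqrt (\<Sum>j = i + 1..n. (a (i, j))\<^sup>2))
        \<le> (\<Sum>i = 1..n - 1. sqrt (\<Sum>j\<in>{1..n}. (w j i)\<^sup>2))"
    proof (intro sum_mono real_sqrt_le_mono)
      fix i assume i: "i \<in> {1..n - 1}"
      have "(\<Sum>j = i + 1..n. (a (i, j))\<^sup>2) = (\<Sum>j = i + 1..n. (w j i)\<^sup>2)"
        using i by (intro sum.cong) (auto simp: w_def b2)
      also have "\<dots> \<le> (\<Sum>j\<in>{1..n}. (w j i)\<^sup>2)" by (intro sum_mono2) auto
      finally show "(\<Sum>j = i + 1..n. (a (i, j))\<^sup>2) \<le> (\<Sum>j\<in>{1..n}. (w j i)\<^sup>2)" .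
    qed
    also have "\<dots> \<le> (\<Sum>i\<in>{1..n}. sqrt (\<Sum>j\<in>{1..n}. (w j i)\<^sup>2))"
      by (intro sum_mono2) (auto intro!: sum_nonneg)
    finally show "(\<Sum>i = 1..n - 1. sqrt (\<Sum>j = i + 1..n. (a (i, j))\<^sup>2))
        \<le> (\<Sum>j\<in>{1..n}. sqrt (\<Sum>i\<in>{1..n}. (w i j)\<^sup>2))" .
    have "(\<Sum>j = 2..n. sqrt (\<Sum>i = 1..j - 1. (a (i, j))\<^sup>2))
        \<le> (\<Sum>j = 2..n. sqrt (\<Sum>i\<in>{1..n}. (w i j)\<^sup>2))"
    proof (intro sum_mono real_sqrt_le_mono)
      fix j assume j: "j \<in> {2..n}"
      have "(\<Sum>i = 1..j - 1. (a (i, j))\<^sup>2) = (\<Sum>i = 1..j - 1. (w i j)\<^sup>2)"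
        using j by (intro sum.cong) (auto simp: w_def b2)
      also have "\<dots> \<le> (\<Sum>i\<in>{1..n}. (w i j)\<^sup>2)" using j by (intro sum_mono2) auto
      finally show "(\<Sum>i = 1..j - 1. (a (i, j))\<^sup>2) \<le> (\<Sum>i\<in>{1..n}. (w i j)\<^sup>2)" .
    qed
    also have "\<dots> \<le> (\<Sum>j\<in>{1..n}. sqrt (\<Sum>i\<in>{1..n}. (w i j)\<^sup>2))"
      by (intro sum_mono2) (auto intro!: sum_nonneg)
    finally show "(\<Sum>j = 2..n. sqrt (\<Sum>i = 1..j - 1. (a (i, j))\<^sup>2))
        \<le> (\<Sum>j\<in>{1..n}. sqrt (\<Sum>i\<in>{1..n}. (w i j)\<^sup>2))" .
  qed
  ultimately show ?thesis by linarith
qed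

lemma Q_le_disc: "9/256 * Q n a \<le> disc n a"
  unfolding disc_def
  using Q_le_disc_coloring finite_colorings colorings_nonempty by (intro Min.boundedI) auto

text \<open>
  One \<open>Q\<close> pays for the row norms and two for the column norms, the factor \<open>2\<close> being the one that the
  contraction of the rows introduces.
\<close>

lemma expected_disc_le: "expected_disc n a \<le> 3 * Q n a"
proof -
  define row where "row i = {e \<in> edges n. fst e = i}" for i
  define col where "col j = {e \<in> edges n. snd e = j}" for j
  define c where "c e I = (if snd e \<in> I then a e else 0)" for e and I :: "nat set"
  define T where "T = Pow {1..n}"
  let ?V = "{1..n}" and ?S = "signs (edges n)"
  have T: "finite T" "T \<noteq> {}" by (auto simp: T_def)
  have fin: "finite (row i)" "finite (col j)" for i j
    by (auto simp: row_def col_def finite_edges)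
  have row_eq: "row i = Pair i ` {i + 1..n}" if "i \<in> ?V" for i
    using that by (auto simp: row_def edges_def)
  have col_eq: "col j = (\<lambda>i. (i, j)) ` {1..j - 1}" if "j \<in> ?V" for j
    using that by (auto simp: col_def edges_def)

  have "(\<Sum>i\<in>?V. sqrt (\<Sum>e\<in>row i. (a e)\<^sup>2)) = (\<Sum>i\<in>?V. sqrt (\<Sum>j = i + 1..n. (a (i, j))\<^sup>2))"
    by (intro sum.cong) (auto simp: row_eq sum.reindex inj_on_def)
  also have "\<dots> = (\<Sum>i = 1..n - 1. sqrt (\<Sum>j = i + 1..n. (a (i, j))\<^sup>2))"
  proof (intro sum.mono_neutral_right ballI)
    fix i assume "i \<in> {1..n} - {1..n - 1}"
    then have "{i + 1..n} = {}" by auto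
    then show "sqrt (\<Sum>j = i + 1..n. (a (i, j))\<^sup>2) = 0" by (simp only: sum.empty real_sqrt_zero)
  qed auto
  finally have rows: "(\<Sum>i\<in>?V. sqrt (\<Sum>e\<in>row i. (a e)\<^sup>2)) \<le> Q n a"
    by (simp add: Q_def)
  have "(\<Sum>j\<in>?V. sqrt (\<Sum>e\<in>col j. (a e)\<^sup>2)) = (\<Sum>j\<in>?V. sqrt (\<Sum>i = 1..j - 1. (a (i, j))\<^sup>2))"
    by (intro sum.cong) (auto simp: col_eq sum.reindex inj_on_def)
  also have "\<dots> = (\<Sum>j = 2..n. sqrt (\<Sum>i = 1..j - 1. (a (i, j))\<^sup>2))"
  proof (intro sum.mono_neutral_right ballI)
    fix j :: nat assume "j \<in> {1..n} - {2..n}"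
    then have "{1..j - 1} = {}" by auto
    then show "sqrt (\<Sum>i = 1..j - 1. (a (i, j))\<^sup>2) = 0" by (simp only: sum.empty real_sqrt_zero)
  qed auto
  finally have cols: "(\<Sum>j\<in>?V. sqrt (\<Sum>e\<in>col j. (a e)\<^sup>2)) \<le> Q n a"
    by (simp add: Q_def)

  \<comment> \<open>The summand \<open>0\<close> is the initial value of \<open>u\<close> in \<open>average_Max_sum_abs_le\<close>.\<close>
  have by_rows: "disc_coloring n a \<theta> \<le> (MAX I\<in>T. 0 + (\<Sum>i\<in>?V. \<bar>\<Sum>e\<in>row i. \<theta> e * c e I\<bar>))" for \<theta>
    unfolding disc_coloring_def
  proof (rule Max.boundedI)
    fix x assume "x \<in> (\<lambda>I. \<bar>\<Sum>e | e \<in> edges n \<and> fst e \<in> I \<and> snd e \<in> I. \<theta> e * a e\<bar>) ` Pow {1..n}"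
    then obtain I where I: "I \<subseteq> {1..n}"
      and x: "x = \<bar>\<Sum>e | e \<in> edges n \<and> fst e \<in> I \<and> snd e \<in> I. \<theta> e * a e\<bar>" by auto
    have finI: "finite I" using I finite_subset by blast
    have "(\<Sum>e | e \<in> edges n \<and> fst e \<in> I \<and> snd e \<in> I. \<theta> e * a e)
        = (\<Sum>e | e \<in> edges n \<and> fst e \<in> I. \<theta> e * c e I)"
      by (intro sum.mono_neutral_cong_left) (auto simp: finite_edges c_def)
    also have "\<dots> = (\<Sum>i\<in>I. \<Sum>e | e \<in> {e. e \<in> edges n \<and> fst e \<in> I} \<and> fst e = i. \<theta> e * c e I)"
      by (rule sum.group[symmetric]) (use finI finite_edges in auto)
    also have "\<dots> = (\<Sum>i\<in>I. \<Sum>e\<in>row i. \<theta> e * c e I)"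
      by (intro sum.cong) (auto simp: row_def)
    finally have "x \<le> (\<Sum>i\<in>I. \<bar>\<Sum>e\<in>row i. \<theta> e * c e I\<bar>)"
      unfolding x by (simp only: sum_abs)
    also have "\<dots> \<le> 0 + (\<Sum>i\<in>?V. \<bar>\<Sum>e\<in>row i. \<theta> e * c e I\<bar>)"
      using I by (simp, intro sum_mono2) auto
    also have "\<dots> \<le> (MAX I\<in>T. 0 + (\<Sum>i\<in>?V. \<bar>\<Sum>e\<in>row i. \<theta> e * c e I\<bar>))"
      using I T by (intro Max_ge) (auto simp: T_def)
    finally show "x \<le> (MAX I\<in>T. 0 + (\<Sum>i\<in>?V. \<bar>\<Sum>e\<in>row i. \<theta> e * c e I\<bar>))" .
  qed auto

  \<comment> \<open>Regrouped by larger endpoints, column \<open>j\<close> contributes its full sum if \<open>j \<in> I\<close> and nothing otherwise.\<close>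
  have by_cols: "(MAX I\<in>T. 0 + (\<Sum>i\<in>?V. 2 * (\<Sum>e\<in>row i. \<theta> e * c e I)))
      \<le> 2 * (\<Sum>j\<in>?V. \<bar>\<Sum>e\<in>col j. \<theta> e * a e\<bar>)" for \<theta>
  proof (rule Max.boundedI)
    fix x assume "x \<in> (\<lambda>I. 0 + (\<Sum>i\<in>?V. 2 * (\<Sum>e\<in>row i. \<theta> e * c e I))) ` T"
    then obtain I where I: "I \<subseteq> {1..n}" and x: "x = 2 * (\<Sum>i\<in>?V. \<Sum>e\<in>row i. \<theta> e * c e I)"
      by (auto simp: T_def sum_distrib_left)
    have "(\<Sum>i\<in>?V. \<Sum>e\<in>row i. \<theta> e * c e I) = (\<Sum>e\<in>edges n. \<theta> e * c e I)"
      unfolding row_def by (rule sum.group) (auto simp: finite_edges, auto simp: edges_def)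
    also have "\<dots> = (\<Sum>j\<in>?V. \<Sum>e\<in>col j. \<theta> e * c e I)"
      unfolding col_def by (rule sum.group[symmetric]) (auto simp: finite_edges, auto simp: edges_def)
    also have "\<dots> \<le> (\<Sum>j\<in>?V. \<bar>\<Sum>e\<in>col j. \<theta> e * a e\<bar>)"
    proof (rule sum_mono)
      fix j
      have "(\<Sum>e\<in>col j. \<theta> e * c e I) = (if j \<in> I then \<Sum>e\<in>col j. \<theta> e * a e else 0)"
        by (auto simp: col_def c_def intro!: sum.cong sum.neutral)
      then show "(\<Sum>e\<in>col j. \<theta> e * c e I) \<le> \<bar>\<Sum>e\<in>col j. \<theta> e * a e\<bar>" by auto
    qed
    finally show "x \<le> 2 * (\<Sum>j\<in>?V. \<bar>\<Sum>e\<in>col j. \<theta> e * a e\<bar>)" using x by simp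
  qed (use T in auto)

  have "expected_disc n a \<le> average ?S (\<lambda>\<theta>. MAX I\<in>T. 0 + (\<Sum>i\<in>?V. \<bar>\<Sum>e\<in>row i. \<theta> e * c e I\<bar>))"
    unfolding expected_disc_eq_average_signs by (intro average_mono by_rows)
  also have "\<dots> \<le> (\<Sum>i\<in>?V. sqrt (\<Sum>e\<in>row i. (a e)\<^sup>2))
      + average ?S (\<lambda>\<theta>. MAX I\<in>T. 0 + (\<Sum>i\<in>?V. 2 * (\<Sum>e\<in>row i. \<theta> e * c e I)))"
  proof (rule average_Max_sum_abs_le[OF finite_edges T])
    show "sqrt (\<Sum>e\<in>row i. (c e I)\<^sup>2) \<le> sqrt (\<Sum>e\<in>row i. (a e)\<^sup>2)" for i I
      by (intro real_sqrt_le_mono sum_mono) (auto simp: c_def)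
  qed (auto simp: row_def disjoint_family_on_def independent_of_def)
  also have "average ?S (\<lambda>\<theta>. MAX I\<in>T. 0 + (\<Sum>i\<in>?V. 2 * (\<Sum>e\<in>row i. \<theta> e * c e I)))
      \<le> average ?S (\<lambda>\<theta>. 2 * (\<Sum>j\<in>?V. \<bar>\<Sum>e\<in>col j. \<theta> e * a e\<bar>))"
    by (intro average_mono by_cols)
  also have "\<dots> = 2 * (\<Sum>j\<in>?V. average ?S (\<lambda>\<theta>. \<bar>\<Sum>e\<in>col j. \<theta> e * a e\<bar>))"
    by (simp only: average_cmult average_sum)
  also have "\<dots> \<le> 2 * (\<Sum>j\<in>?V. sqrt (\<Sum>e\<in>col j. (a e)\<^sup>2))"
    by (intro mult_left_mono sum_mono average_abs_le) (auto simp: finite_edges col_def)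
  finally show ?thesis using rows cols by linarith
qed

theorem theorem6:
  shows "\<exists>c C :: real. 0 < c \<and> c \<le> C \<and>
    (\<forall>(n :: nat) (a :: nat \<times> nat \<Rightarrow> real).
       c * Q n a \<le> disc n a \<and> disc n a \<le> C * Q n a \<and>
       c * Q n a \<le> expected_disc n a \<and> expected_disc n a \<le> C * Q n a)"
proof (rule exI[of _ "9/256"], rule exI[of _ 3], intro conjI allI)
  fix n and a :: "nat \<times> nat \<Rightarrow> real"
  show "9/256 * Q n a \<le> disc n a" by (rule Q_le_disc)
  show "disc n a \<le> 3 * Q n a"
    using disc_le_expected_disc expected_disc_le by (rule order_trans)
  show "9/256 * Q n a \<le> expected_disc n a"
    using Q_le_disc disc_le_expected_disc by (rule order_trans)
  show "expected_disc n a \<le> 3 * Q n a" by (rule expected_disc_le)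
qed auto

end
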